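(* Assume (H1)–(H2) of the context, let $F$ be a given real-valued function on $\Gamma$, and let $u,v\in\mathscr C^2(\Gamma)$ be respectively a sub-solution and a super-solution (as defined in the context) of $$(\mathrm{HJB}_\lambda)\quad\begin{cases}-\mu_\alpha\partial^2u(x)+H(x,\partial u(x))+\lambda u(x)=F(x)&\text{for all }x\in\Gamma_\alpha\setminus\mathcal V,\ \alpha\in\mathcal A,\\ u_{|\Gamma_\alpha}(\mathrm v)=u_{|\Gamma_\beta}(\mathrm v)&\text{for all }\alpha,\beta\in\mathcal A_{\mathrm v},\ \mathrm v\in\mathcal V,\\ \sum_{\alpha\in\mathcal A_{\mathrm v}}\mu_\alpha\gamma_{\mathrm v,\alpha}\,\partial_\alpha u(\mathrm v)=\eta_{\mathrm v}(\theta_{\mathrm v}-\lambda u(\mathrm v))&\text{for all }\mathrm v\in\mathcal V\setminus\partial\mathcal V,\\ \partial_\alpha u(\mathrm v)=0&\text{for all }\mathrm v\in\partial\mathcal V,\ \alpha\in\mathcal A_{\mathrm v}.\end{cases}$$ Then $u\le v$ in $\Gamma$. In particular there exists at most one classical solution ($u\in\mathscr C^2(\Gamma)$) to $(\mathrm{HJB}_\lambda)$.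
   Context: Network. $\mathcal V\subset\mathbb R^d$ is a finite set of vertices; $P\subset\mathcal V\times\mathcal V$ contains no pair $(\mathrm v,\mathrm v)$, and every vertex occurs in at least one pair of $P$. The edges are the segments joining the two points of a pair in $P$, indexed as $\Gamma_\alpha$, $\alpha\in\mathcal A$ ($\mathcal A$ finite); for $\alpha\ne\beta$, $\Gamma_\alpha\cap\Gamma_\beta=\{\mathrm v\}$ if both edges contain the vertex $\mathrm v$, and $\Gamma_\alpha\cap\Gamma_\beta=\varnothing$ otherwise. The network $\Gamma=\bigcup_{\alpha}\Gamma_\alpha$ is assumed connected and carries its geodesic distance. $\mathcal A_{\mathrm v}=\{\alpha\in\mathcal A: \mathrm v\in\Gamma_\alpha\}$; $\partial\mathcal V$ is the set of boundary vertices, i.e. those $\mathrm v$ for which there is a unique $\bar{\mathrm v}\in\mathcal V$ with $(\mathrm v,\bar{\mathrm v})\in P$ or $(\bar{\mathrm v},\mathrm v)\in P$. An edge $\Gamma_\alpha$ with vertices $\mathrm v_i,\mathrm v_j$ and length $L_\alpha$ is parametrized by $\pi_\alpha(s)=\mathrm v_i+s\,e_\alpha$, $e_\alpha=(\mathrm v_j-\mathrm v_i)/L_\alpha$, $s\in[0,L_\alpha]$. For $u:\Gamma\to\mathbb R$, $u_\alpha=u\circ\pi_\alpha$ on $(0,L_\alpha)$, and $u_{|\Gamma_\alpha}(\mathrm v)$ is the limit of $u_\alpha$ at the endpoint corresponding to $\mathrm v\in\Gamma_\alpha$. $\partial u$, $\partial^2u$ inside $\Gamma_\alpha$ are derivatives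 of $u_\alpha$ with respect to $s$. At a vertex $\mathrm v\in\Gamma_\alpha$, $\partial_\alpha u(\mathrm v)$ is the outward derivative: $-u_\alpha'(0)$ if $\mathrm v=\pi_\alpha(0)$, $u_\alpha'(L_\alpha)$ if $\mathrm v=\pi_\alpha(L_\alpha)$. Spaces. $\mathscr C^k(\Gamma)$: continuous functions on $\Gamma$ with $u_\alpha\in C^k([0,L_\alpha])$ for all $\alpha$. Sub/super-solutions. $u\in\mathscr C^2(\Gamma)$ is a sub-solution if $-\mu_\alpha\partial^2u+H(x,\partial u)+\lambda u\le F$ on $\Gamma_\alpha\setminus\mathcal V$ for all $\alpha$; $\sum_{\alpha\in\mathcal A_{\mathrm v}}\mu_\alpha\gamma_{\mathrm v,\alpha}\partial_\alpha u(\mathrm v)\le\eta_{\mathrm v}(\theta_{\mathrm v}-\lambda u(\mathrm v))$ for all $\mathrm v\in\mathcal V\setminus\partial\mathcal V$; and $\partial_\alpha u(\mathrm v)\le0$ for all $\mathrm v\in\partial\mathcal V$. A super-solution is defined by reversing all three inequalities. (H1) $\lambda>0$; for each $\mathrm v\in\mathcal V\setminus\partial\mathcal V$ and $\alpha\in\mathcal A_{\mathrm v}$: $\gamma_{\mathrm v,\alpha}>0$, $\eta_{\mathrm v}\ge0$, $\theta_{\mathrm v}\in\mathbb R$; $\mu_\alpha>0$ for all $\alpha\in\mathcal A$; and $\sum_{\alpha\in\mathcal A_{\mathrm v}}\mu_\alpha\gamma_{\mathrm v,\alpha}=1$ for all $\mathrm v\in\mathcal V\setminus\partial\mathcal V$.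 (H2) For each $\alpha\in\mathcal A$, the map $H_\alpha:\Gamma_\alpha\times\mathbb R\to\mathbb R$, $H_\alpha(x,p)=H(x,p)$ for $x\in\Gamma_\alpha\setminus\mathcal V$ and $H_\alpha(x,p)=\lim_{y\to x,\,y\in\Gamma_\alpha\setminus\mathcal V}H(y,p)$ for $x\in\mathcal V$, is well defined and continuous; for each $x\in\Gamma_\alpha\setminus\mathcal V$, $p\mapsto H_\alpha(x,p)$ is continuously differentiable and $\partial_pH_\alpha$ extends to a continuous map on $\Gamma_\alpha\times\mathbb R$. There exist $C_H>0$ and $q\in(1,2]$ such that for all $(x,p)\in\Gamma_\alpha\times\mathbb R$: $|H_\alpha(x,p)|\le C_H(1+|p|^q)$, $|\partial_pH_\alpha(x,p)|\le C_H(1+|p|^{q-1})$, $H_\alpha(x,p)\ge C_H^{-1}|p|^q-C_H$. *)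

theory Defs
  imports "HOL-Analysis.Analysis"
begin


text \<open>The edges are indexed by a finite set \<open>idx\<close>; the edge \<open>\<alpha>\<close> is parametrized from
  \<open>src \<alpha>\<close> to \<open>tgt \<alpha>\<close>. The orientation is arbitrary: it need not be the one of the pair in
  \<open>pairs\<close>, and two opposite pairs describe the same edge.\<close>

record ('a, 'i) network =
  verts :: "'a set"
  pairs :: "('a \<times> 'a) set"
  idx :: "'i set"
  src :: "'i \<Rightarrow> 'a"
  tgt :: "'i \<Rightarrow> 'a"

definition edge :: "('a::euclidean_space, 'i) network \<Rightarrow> 'i \<Rightarrow> 'a set" where
  "edge N \<alpha> = closed_segment (src N \<alpha>) (tgt N \<alpha>)"

definition ends :: "('a, 'i) network \<Rightarrow> 'i \<Rightarrow> 'a set" where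
  "ends N \<alpha> = {src N \<alpha>, tgt N \<alpha>}"

definition net :: "('a::euclidean_space, 'i) network \<Rightarrow> 'a set" where
  "net N = (\<Union>\<alpha>\<in>idx N. edge N \<alpha>)"

text \<open>In the intersection condition, ``both edges contain the vertex \<open>v\<close>'' is read as
  ``\<open>v\<close> is an endpoint of both''. With the set-theoretic reading a vertex could lie in the
  relative interior of an edge, where no outward derivative is defined.\<close>

definition is_network :: "('a::euclidean_space, 'i) network \<Rightarrow> bool" where
  "is_network N \<longleftrightarrow>
     finite (verts N) \<and>
     pairs N \<subseteq> verts N \<times> verts N \<and>
     (\<forall>v. (v, v) \<notin> pairs N) \<and>
     (\<forall>v\<in>verts N. \<exists>w. (v, w) \<in> pairs N \<or> (w, v) \<in> pairs N) \<and>
     finite (idx N) \<and>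
     ends N ` idx N = {{v, w} | v w. (v, w) \<in> pairs N} \<and>
     (\<forall>\<alpha>\<in>idx N. \<forall>\<beta>\<in>idx N. \<alpha> \<noteq> \<beta> \<longrightarrow>
        (\<forall>v\<in>ends N \<alpha> \<inter> ends N \<beta>. edge N \<alpha> \<inter> edge N \<beta> = {v}) \<and>
        (ends N \<alpha> \<inter> ends N \<beta> = {} \<longrightarrow> edge N \<alpha> \<inter> edge N \<beta> = {})) \<and>
     connected (net N)"

definition incident :: "('a::euclidean_space, 'i) network \<Rightarrow> 'a \<Rightarrow> 'i set" where
  "incident N v = {\<alpha>\<in>idx N. v \<in> edge N \<alpha>}"

definition bdry :: "('a, 'i) network \<Rightarrow> 'a set" where
  "bdry N = {v\<in>verts N. \<exists>!w. w \<in> verts N \<and> ((v, w) \<in> pairs N \<or> (w, v) \<in> pairs N)}"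

definition len :: "('a::euclidean_space, 'i) network \<Rightarrow> 'i \<Rightarrow> real" where
  "len N \<alpha> = dist (src N \<alpha>) (tgt N \<alpha>)"

definition param :: "('a::euclidean_space, 'i) network \<Rightarrow> 'i \<Rightarrow> real \<Rightarrow> 'a" where
  "param N \<alpha> s = src N \<alpha> + s *\<^sub>R ((tgt N \<alpha> - src N \<alpha>) /\<^sub>R len N \<alpha>)"

text \<open>Geodesic distance: infimum of the lengths of the piecewise \<open>C\<^sup>1\<close> curves of finite length
  inside the network.\<close>

definition geodist :: "('a::euclidean_space, 'i) network \<Rightarrow> 'a \<Rightarrow> 'a \<Rightarrow> real" where
  "geodist N x y = Inf {l. \<exists>g. valid_path g \<and> path_image g \<subseteq> net N \<and>
       pathstart g = x \<and> pathfinish g = y \<and>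
       ((\<lambda>t. norm (vector_derivative g (at t))) has_integral l) {0..1}}"

definition continuous_on_net :: "('a::euclidean_space, 'i) network \<Rightarrow> ('a \<Rightarrow> real) \<Rightarrow> bool" where
  "continuous_on_net N u \<longleftrightarrow>
     (\<forall>x\<in>net N. \<forall>\<epsilon>>0. \<exists>\<delta>>0. \<forall>y\<in>net N. geodist N x y < \<delta> \<longrightarrow> \<bar>u y - u x\<bar> < \<epsilon>)"



text \<open>A function on the network is a total function of which only the values on \<open>net N\<close>
  matter.\<close>

definition on_edge :: "('a::euclidean_space, 'i) network \<Rightarrow> ('a \<Rightarrow> real) \<Rightarrow> 'i \<Rightarrow> real \<Rightarrow> real" where
  "on_edge N u \<alpha> s = u (param N \<alpha> s)"

text \<open>\<open>C\<^sup>k\<close> on a compact interval, with one-sided derivatives at the endpoints.\<close>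

definition Ck_on_interval :: "nat \<Rightarrow> (real \<Rightarrow> real) \<Rightarrow> real \<Rightarrow> real \<Rightarrow> bool" where
  "Ck_on_interval k f a b \<longleftrightarrow>
     (\<exists>D :: nat \<Rightarrow> real \<Rightarrow> real.
        (\<forall>s\<in>{a..b}. D 0 s = f s) \<and>
        (\<forall>i<k. \<forall>s\<in>{a..b}. (D i has_real_derivative D (Suc i) s) (at s within {a..b})) \<and>
        (\<forall>i\<le>k. continuous_on {a..b} (D i)))"

definition Ck_net :: "nat \<Rightarrow> ('a::euclidean_space, 'i) network \<Rightarrow> ('a \<Rightarrow> real) \<Rightarrow> bool" where
  "Ck_net k N u \<longleftrightarrow>
     continuous_on_net N u \<and> (\<forall>\<alpha>\<in>idx N. Ck_on_interval k (on_edge N u \<alpha>) 0 (len N \<alpha>))"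

text \<open>The first two derivatives of \<open>u\<close> along the edge \<open>\<alpha>\<close>, as functions of the arc length
  parameter (one-sided at \<open>0\<close> and \<open>len N \<alpha>\<close>).\<close>

definition edge_deriv ::
  "('a::euclidean_space, 'i) network \<Rightarrow> ('a \<Rightarrow> real) \<Rightarrow> 'i \<Rightarrow> real \<Rightarrow> real" where
  "edge_deriv N u \<alpha> s = vector_derivative (on_edge N u \<alpha>) (at s within {0..len N \<alpha>})"

definition edge_deriv2 ::
  "('a::euclidean_space, 'i) network \<Rightarrow> ('a \<Rightarrow> real) \<Rightarrow> 'i \<Rightarrow> real \<Rightarrow> real" where
  "edge_deriv2 N u \<alpha> s = vector_derivative (edge_deriv N u \<alpha>) (at s within {0..len N \<alpha>})"

text \<open>Only meant for \<open>v \<in> ends N \<alpha>\<close>.\<close>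

definition outward_deriv ::
  "('a::euclidean_space, 'i) network \<Rightarrow> ('a \<Rightarrow> real) \<Rightarrow> 'i \<Rightarrow> 'a \<Rightarrow> real" where
  "outward_deriv N u \<alpha> v =
     (if v = src N \<alpha> then - edge_deriv N u \<alpha> 0 else edge_deriv N u \<alpha> (len N \<alpha>))"

definition edge_trace ::
  "('a::euclidean_space, 'i) network \<Rightarrow> ('a \<Rightarrow> real) \<Rightarrow> 'i \<Rightarrow> 'a \<Rightarrow> real" where
  "edge_trace N u \<alpha> v =
     (if v = src N \<alpha> then Lim (at_right 0) (on_edge N u \<alpha>)
      else Lim (at_left (len N \<alpha>)) (on_edge N u \<alpha>))"



record ('a, 'i) hjb_data =
  mu :: "'i \<Rightarrow> real"
  gam :: "'a \<Rightarrow> 'i \<Rightarrow> real"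
  eta :: "'a \<Rightarrow> real"
  theta :: "'a \<Rightarrow> real"
  lam :: real
  ham :: "'a \<Rightarrow> real \<Rightarrow> real"

definition H1 :: "('a::euclidean_space, 'i) network \<Rightarrow> ('a, 'i) hjb_data \<Rightarrow> bool" where
  "H1 N Q \<longleftrightarrow>
     lam Q > 0 \<and>
     (\<forall>v\<in>verts N - bdry N. \<forall>\<alpha>\<in>incident N v. gam Q v \<alpha> > 0) \<and>
     (\<forall>v\<in>verts N - bdry N. eta Q v \<ge> 0) \<and>
     (\<forall>\<alpha>\<in>idx N. mu Q \<alpha> > 0) \<and>
     (\<forall>v\<in>verts N - bdry N. (\<Sum>\<alpha>\<in>incident N v. mu Q \<alpha> * gam Q v \<alpha>) = 1)"

definition ham_edge ::
  "('a::euclidean_space, 'i) network \<Rightarrow> ('a \<Rightarrow> real \<Rightarrow> real) \<Rightarrow> 'i \<Rightarrow> 'a \<Rightarrow> real \<Rightarrow> real" where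
  "ham_edge N H \<alpha> x p =
     (if x \<in> verts N then Lim (at x within edge N \<alpha> - verts N) (\<lambda>y. H y p) else H x p)"

text \<open>Below, \<open>G\<close> is the continuous extension of \<open>\<partial>\<^sub>p H\<^sub>\<alpha>\<close> to the whole closed edge; it is
  unique because \<open>edge N \<alpha> - verts N\<close> is dense in \<open>edge N \<alpha>\<close>.\<close>

definition H2 :: "('a::euclidean_space, 'i) network \<Rightarrow> ('a, 'i) hjb_data \<Rightarrow> bool" where
  "H2 N Q \<longleftrightarrow> (\<forall>\<alpha>\<in>idx N.
     (\<forall>x\<in>edge N \<alpha> \<inter> verts N. \<forall>p. \<exists>l.
        ((\<lambda>y. ham Q y p) \<longlongrightarrow> l) (at x within edge N \<alpha> - verts N)) \<and>
     continuous_on (edge N \<alpha> \<times> UNIV) (\<lambda>(x, p). ham_edge N (ham Q) \<alpha> x p) \<and>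
     (\<forall>x\<in>edge N \<alpha> - verts N. (\<lambda>p. ham_edge N (ham Q) \<alpha> x p) C1_differentiable_on UNIV) \<and>
     (\<exists>G :: 'a \<Rightarrow> real \<Rightarrow> real.
        continuous_on (edge N \<alpha> \<times> UNIV) (\<lambda>(x, p). G x p) \<and>
        (\<forall>x\<in>edge N \<alpha> - verts N. \<forall>p. G x p = deriv (\<lambda>r. ham_edge N (ham Q) \<alpha> x r) p) \<and>
        (\<exists>C q. C > 0 \<and> 1 < q \<and> q \<le> 2 \<and>
           (\<forall>x\<in>edge N \<alpha>. \<forall>p.
              \<bar>ham_edge N (ham Q) \<alpha> x p\<bar> \<le> C * (1 + \<bar>p\<bar> powr q) \<and>
              \<bar>G x p\<bar> \<le> C * (1 + \<bar>p\<bar> powr (q - 1)) \<and>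
              ham_edge N (ham Q) \<alpha> x p \<ge> inverse C * \<bar>p\<bar> powr q - C))))"

text \<open>The left-hand side of the differential equation at the point \<open>param N \<alpha> s\<close>.\<close>

definition hjb_op ::
  "('a::euclidean_space, 'i) network \<Rightarrow> ('a, 'i) hjb_data \<Rightarrow> ('a \<Rightarrow> real) \<Rightarrow> 'i \<Rightarrow> real \<Rightarrow> real" where
  "hjb_op N Q u \<alpha> s =
     - mu Q \<alpha> * edge_deriv2 N u \<alpha> s + ham Q (param N \<alpha> s) (edge_deriv N u \<alpha> s)
       + lam Q * u (param N \<alpha> s)"

definition kirchhoff_sum ::
  "('a::euclidean_space, 'i) network \<Rightarrow> ('a, 'i) hjb_data \<Rightarrow> ('a \<Rightarrow> real) \<Rightarrow> 'a \<Rightarrow> real" where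
  "kirchhoff_sum N Q u v = (\<Sum>\<alpha>\<in>incident N v. mu Q \<alpha> * gam Q v \<alpha> * outward_deriv N u \<alpha> v)"

definition sub_solution ::
  "('a::euclidean_space, 'i) network \<Rightarrow> ('a, 'i) hjb_data \<Rightarrow> ('a \<Rightarrow> real) \<Rightarrow> ('a \<Rightarrow> real) \<Rightarrow> bool" where
  "sub_solution N Q F u \<longleftrightarrow>
     Ck_net 2 N u \<and>
     (\<forall>\<alpha>\<in>idx N. \<forall>s\<in>{0..len N \<alpha>}. param N \<alpha> s \<notin> verts N \<longrightarrow>
        hjb_op N Q u \<alpha> s \<le> F (param N \<alpha> s)) \<and>
     (\<forall>v\<in>verts N - bdry N. kirchhoff_sum N Q u v \<le> eta Q v * (theta Q v - lam Q * u v)) \<and>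
     (\<forall>v\<in>bdry N. \<forall>\<alpha>\<in>incident N v. outward_deriv N u \<alpha> v \<le> 0)"

definition super_solution ::
  "('a::euclidean_space, 'i) network \<Rightarrow> ('a, 'i) hjb_data \<Rightarrow> ('a \<Rightarrow> real) \<Rightarrow> ('a \<Rightarrow> real) \<Rightarrow> bool" where
  "super_solution N Q F u \<longleftrightarrow>
     Ck_net 2 N u \<and>
     (\<forall>\<alpha>\<in>idx N. \<forall>s\<in>{0..len N \<alpha>}. param N \<alpha> s \<notin> verts N \<longrightarrow>
        hjb_op N Q u \<alpha> s \<ge> F (param N \<alpha> s)) \<and>
     (\<forall>v\<in>verts N - bdry N. kirchhoff_sum N Q u v \<ge> eta Q v * (theta Q v - lam Q * u v)) \<and>
     (\<forall>v\<in>bdry N. \<forall>\<alpha>\<in>incident N v. outward_deriv N u \<alpha> v \<ge> 0)"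

definition classical_solution ::
  "('a::euclidean_space, 'i) network \<Rightarrow> ('a, 'i) hjb_data \<Rightarrow> ('a \<Rightarrow> real) \<Rightarrow> ('a \<Rightarrow> real) \<Rightarrow> bool" where
  "classical_solution N Q F u \<longleftrightarrow>
     Ck_net 2 N u \<and>
     (\<forall>\<alpha>\<in>idx N. \<forall>s\<in>{0..len N \<alpha>}. param N \<alpha> s \<notin> verts N \<longrightarrow>
        hjb_op N Q u \<alpha> s = F (param N \<alpha> s)) \<and>
     (\<forall>v\<in>verts N. \<forall>\<alpha>\<in>incident N v. \<forall>\<beta>\<in>incident N v.
        edge_trace N u \<alpha> v = edge_trace N u \<beta> v) \<and>
     (\<forall>v\<in>verts N - bdry N. kirchhoff_sum N Q u v = eta Q v * (theta Q v - lam Q * u v)) \<and>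
     (\<forall>v\<in>bdry N. \<forall>\<alpha>\<in>incident N v. outward_deriv N u \<alpha> v = 0)"

end

theory Submission
  imports Defs
begin

text \<open>The proof is the maximum principle for \<open>w = u - v\<close>, run on the closed edges rather than in
  their interiors. The function \<open>w\<close> attains its maximum over the network at some point \<open>x\<close>
  of some edge, because the network is a finite union of compact arcs. If \<open>w' = 0\<close> at \<open>x\<close>
  along that edge, then \<open>w'' \<le> 0\<close> there, and this holds at an end of the edge as well, with
  one-sided derivatives (\<open>interval_max_second_deriv\<close>). As the two gradients agree at \<open>x\<close>,
  the Hamiltonians cancel when the two differential inequalities are subtracted, and what is
  left is \<open>\<lambda> w(x) \<le> \<mu> w''(x) \<le> 0\<close>. At an end of the edge the inequalities are not part of the
  hypotheses, but they extend to it by continuity of \<open>H\<^sub>\<alpha>\<close> and of the second derivatives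
  (\<open>sub_super_ineq_closed_edge\<close>).

  It remains to see that \<open>w'\<close> vanishes at \<open>x\<close>. Inside an edge this is Fermat's rule. At a
  vertex every outward derivative of \<open>w\<close> is nonnegative, since \<open>w\<close> is maximal there. At a boundary
  vertex the Neumann condition makes it nonpositive. At any other vertex, if \<open>w(x) > 0\<close>, the
  Kirchhoff conditions make a combination of the outward derivatives with positive
  weights at most \<open>- \<eta> \<lambda> w(x) \<le> 0\<close>, so all of them vanish
  (\<open>outward_deriv_zero_at_vertex_max\<close>). Thus the vertex conditions produce a critical
  point, and the contradiction always comes from the differential inequality on one edge.\<close>

section \<open>Maxima of functions on a compact interval\<close>

lemma interval_max_first_deriv:
  fixes f :: "real \<Rightarrow> real"
  assumes der: "(f has_real_derivative l) (at c within {a..b})"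
    and c: "c \<in> {a..b}" and max: "\<And>t. t \<in> {a..b} \<Longrightarrow> f t \<le> f c"
  shows "c < b \<Longrightarrow> l \<le> 0" and "a < c \<Longrightarrow> l \<ge> 0"
proof -
  show "l \<le> 0" if "c < b"
  proof (rule ccontr)
    assume "\<not> l \<le> 0"
    then obtain d where d: "d > 0" "\<And>h. 0 < h \<Longrightarrow> c + h \<in> {a..b} \<Longrightarrow> h < d \<Longrightarrow> f c < f (c + h)"
      using has_real_derivative_pos_inc_right[OF der] by auto
    define h where "h = min (d / 2) (b - c)"
    have "0 < h" "c + h \<in> {a..b}" "h < d" using that c d(1) by (auto simp: h_def min_def)
    then show False using d(2) max by fastforce
  qed
  show "l \<ge> 0" if "a < c"
  proof (rule ccontr)
    assume "\<not> l \<ge> 0"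
    then obtain d where d: "d > 0" "\<And>h. 0 < h \<Longrightarrow> c - h \<in> {a..b} \<Longrightarrow> h < d \<Longrightarrow> f c < f (c - h)"
      using has_real_derivative_neg_dec_left[OF der] by auto
    define h where "h = min (d / 2) (c - a)"
    have "0 < h" "c - h \<in> {a..b}" "h < d" using that c d(1) by (auto simp: h_def min_def)
    then show False using d(2) max by fastforce
  qed
qed

text \<open>If \<open>f'(c) = 0 < f''(c)\<close>, then \<open>f'\<close> is positive just to the right of \<open>c\<close> and negative just
  to the left, so \<open>f\<close> exceeds \<open>f(c)\<close> on whichever side of \<open>c\<close> the interval offers. One
  side is enough, which is why \<open>c\<close> may be an end of the interval.\<close>

lemma interval_max_second_deriv:
  fixes f f1 :: "real \<Rightarrow> real"
  assumes ab: "a < b"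
    and der: "\<And>t. t \<in> {a..b} \<Longrightarrow> (f has_real_derivative f1 t) (at t within {a..b})"
    and der1: "(f1 has_real_derivative l) (at c within {a..b})"
    and c: "c \<in> {a..b}" and max: "\<And>t. t \<in> {a..b} \<Longrightarrow> f t \<le> f c" and crit: "f1 c = 0"
  shows "l \<le> 0"
proof (rule ccontr)
  assume "\<not> l \<le> 0"
  then have l: "l > 0" by simp
  have mvt: "\<exists>z\<in>{x<..<y}. f y - f x = f1 z * (y - x)" if "x < y" "{x..y} \<subseteq> {a..b}" for x y
  proof (rule mvt_simple[OF that(1)])
    fix t assume "x \<le> t" "t \<le> y"
    then have "(f has_real_derivative f1 t) (at t within {x..y})"
      using that(2) by (intro DERIV_subset[OF der that(2)]) auto
    then show "(f has_derivative (*) (f1 t)) (at t within {x..y})"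
      by (simp add: has_field_derivative_def)
  qed
  show False
  proof (cases "c < b")
    case True
    obtain d where d: "d > 0" "\<And>h. 0 < h \<Longrightarrow> c + h \<in> {a..b} \<Longrightarrow> h < d \<Longrightarrow> 0 < f1 (c + h)"
      using has_real_derivative_pos_inc_right[OF der1 l] crit by auto
    define h where "h = min (d / 2) (b - c)"
    have h: "0 < h" "c + h \<in> {a..b}" "h < d" using True c d(1) by (auto simp: h_def min_def)
    obtain z where z: "z \<in> {c<..<c + h}" "f (c + h) - f c = f1 z * h"
      using mvt[of c "c + h"] h c by auto
    have "f1 z > 0" using d(2)[of "z - c"] z(1) h c by auto
    then have "f (c + h) > f c" using z(2) h(1) by (metis diff_gt_0_iff_gt mult_pos_pos)
    then show False using max[OF h(2)] by simp
  next
    case False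
    then have "a < c" using ab c by auto
    obtain d where d: "d > 0" "\<And>h. 0 < h \<Longrightarrow> c - h \<in> {a..b} \<Longrightarrow> h < d \<Longrightarrow> f1 (c - h) < 0"
      using has_real_derivative_pos_inc_left[OF der1 l] crit by auto
    define h where "h = min (d / 2) (c - a)"
    have h: "0 < h" "c - h \<in> {a..b}" "h < d" using \<open>a < c\<close> c d(1) by (auto simp: h_def min_def)
    obtain z where z: "z \<in> {c - h<..<c}" "f c - f (c - h) = f1 z * h"
      using mvt[of "c - h" c] h c by auto
    have "f1 z < 0" using d(2)[of "c - z"] z(1) h c by auto
    then have "f (c - h) > f c" using z(2) h(1) by (metis diff_less_0_iff_less mult_neg_pos)
    then show False using max[OF h(2)] by simp
  qed
qed

section \<open>Edges and vertices\<close>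

lemma is_networkD:
  assumes "is_network N"
  shows "\<And>v w. (v, w) \<in> pairs N \<Longrightarrow> v \<in> verts N \<and> w \<in> verts N \<and> v \<noteq> w"
    and "\<And>v. v \<in> verts N \<Longrightarrow> \<exists>w. (v, w) \<in> pairs N \<or> (w, v) \<in> pairs N"
    and "finite (idx N)"
    and "ends N ` idx N = {{v, w} | v w. (v, w) \<in> pairs N}"
    and "\<And>\<alpha> \<beta> v. \<lbrakk>\<alpha> \<in> idx N; \<beta> \<in> idx N; \<alpha> \<noteq> \<beta>; v \<in> ends N \<alpha> \<inter> ends N \<beta>\<rbrakk>
      \<Longrightarrow> edge N \<alpha> \<inter> edge N \<beta> = {v}"
    and "\<And>\<alpha> \<beta>. \<lbrakk>\<alpha> \<in> idx N; \<beta> \<in> idx N; \<alpha> \<noteq> \<beta>; ends N \<alpha> \<inter> ends N \<beta> = {}\<rbrakk>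
      \<Longrightarrow> edge N \<alpha> \<inter> edge N \<beta> = {}"
proof -
  note a = assms[unfolded is_network_def]
  show "v \<in> verts N \<and> w \<in> verts N \<and> v \<noteq> w" if "(v, w) \<in> pairs N" for v w
  proof -
    have "pairs N \<subseteq> verts N \<times> verts N" "(v, v) \<notin> pairs N" using a by simp_all
    with that show ?thesis by blast
  qed
  show "\<exists>w. (v, w) \<in> pairs N \<or> (w, v) \<in> pairs N" if "v \<in> verts N" for v
    using a that by simp
  show "finite (idx N)" "ends N ` idx N = {{v, w} | v w. (v, w) \<in> pairs N}"
    using a by simp_all
  show "edge N \<alpha> \<inter> edge N \<beta> = {v}"
    if "\<alpha> \<in> idx N" "\<beta> \<in> idx N" "\<alpha> \<noteq> \<beta>" "v \<in> ends N \<alpha> \<inter> ends N \<beta>" for \<alpha> \<beta> v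
    using a that by simp
  show "edge N \<alpha> \<inter> edge N \<beta> = {}"
    if "\<alpha> \<in> idx N" "\<beta> \<in> idx N" "\<alpha> \<noteq> \<beta>" "ends N \<alpha> \<inter> ends N \<beta> = {}" for \<alpha> \<beta>
    using a that by simp
qed

lemma edge_ends:
  assumes "is_network N" and "\<alpha> \<in> idx N"
  shows "src N \<alpha> \<in> verts N" and "tgt N \<alpha> \<in> verts N" and "src N \<alpha> \<noteq> tgt N \<alpha>" and "0 < len N \<alpha>"
proof -
  have "ends N \<alpha> \<in> {{v, w} | v w. (v, w) \<in> pairs N}"
    using imageI[OF assms(2), of "ends N"] unfolding is_networkD(4)[OF assms(1)] .
  then obtain v w where vw: "{src N \<alpha>, tgt N \<alpha>} = {v, w}" "(v, w) \<in> pairs N"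
    by (auto simp: ends_def)
  have "v \<noteq> w" "v \<in> verts N" "w \<in> verts N"
    using is_networkD(1)[OF assms(1) vw(2)] by simp_all
  with vw(1) show "src N \<alpha> \<in> verts N" "tgt N \<alpha> \<in> verts N" "src N \<alpha> \<noteq> tgt N \<alpha>"
    by (auto simp: doubleton_eq_iff)
  then show "0 < len N \<alpha>" by (simp add: len_def)
qed

lemma param_0: "param N \<alpha> 0 = src N \<alpha>"
  by (simp add: param_def)

lemma param_len: "0 < len N \<alpha> \<Longrightarrow> param N \<alpha> (len N \<alpha>) = tgt N \<alpha>"
  by (simp add: param_def)

lemma param_image_edge:
  assumes "0 < len N \<alpha>"
  shows "param N \<alpha> ` {0..len N \<alpha>} = edge N \<alpha>"
proof
  have eq: "param N \<alpha> s = (1 - s / len N \<alpha>) *\<^sub>R src N \<alpha> + (s / len N \<alpha>) *\<^sub>R tgt N \<alpha>" for s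
    by (simp add: param_def algebra_simps divide_inverse)
  show "param N \<alpha> ` {0..len N \<alpha>} \<subseteq> edge N \<alpha>"
  proof
    fix x assume "x \<in> param N \<alpha> ` {0..len N \<alpha>}"
    then obtain s where "s \<in> {0..len N \<alpha>}" "x = param N \<alpha> s" by blast
    then show "x \<in> edge N \<alpha>"
      using assms eq[of s] unfolding edge_def in_segment
      by (intro exI[of _ "s / len N \<alpha>"]) auto
  qed
  show "edge N \<alpha> \<subseteq> param N \<alpha> ` {0..len N \<alpha>}"
  proof
    fix x assume "x \<in> edge N \<alpha>"
    then obtain r where r: "0 \<le> r" "r \<le> 1" "x = (1 - r) *\<^sub>R src N \<alpha> + r *\<^sub>R tgt N \<alpha>"
      unfolding edge_def in_segment by auto
    then have "x = param N \<alpha> (r * len N \<alpha>)" "r * len N \<alpha> \<in> {0..len N \<alpha>}"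
      using assms eq[of "r * len N \<alpha>"] by (auto simp: mult_le_cancel_right1)
    then show "x \<in> param N \<alpha> ` {0..len N \<alpha>}" by blast
  qed
qed

lemma inj_param:
  assumes "0 < len N \<alpha>"
  shows "inj (param N \<alpha>)"
proof (rule injI)
  fix s t assume "param N \<alpha> s = param N \<alpha> t"
  then have "s *\<^sub>R ((tgt N \<alpha> - src N \<alpha>) /\<^sub>R len N \<alpha>) = t *\<^sub>R ((tgt N \<alpha> - src N \<alpha>) /\<^sub>R len N \<alpha>)"
    by (simp add: param_def)
  moreover have "(tgt N \<alpha> - src N \<alpha>) /\<^sub>R len N \<alpha> \<noteq> 0" using assms by (auto simp: len_def)
  ultimately show "s = t" by (metis scaleR_cancel_right)
qed

text \<open>A vertex is an end of some edge \<open>\<beta>\<close>. If it lies on another edge \<open>\<alpha>\<close>, the two edges meet,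
  hence meet only in a common end, which is the vertex.\<close>

lemma vertex_on_edge_is_end:
  assumes net: "is_network N" and \<alpha>: "\<alpha> \<in> idx N" and v: "v \<in> verts N" "v \<in> edge N \<alpha>"
  shows "v \<in> ends N \<alpha>"
proof -
  obtain w where "(v, w) \<in> pairs N \<or> (w, v) \<in> pairs N"
    using is_networkD(2)[OF net v(1)] by blast
  then have "{v, w} \<in> {{v, w} | v w. (v, w) \<in> pairs N}"
    by (auto simp: insert_commute)
  then have "{v, w} \<in> ends N ` idx N"
    unfolding is_networkD(4)[OF net] .
  then obtain \<beta> where "\<beta> \<in> idx N" "{v, w} = ends N \<beta>" by (rule imageE)
  then have \<beta>: "\<beta> \<in> idx N" "v \<in> ends N \<beta>" by auto
  have v\<beta>: "v \<in> edge N \<beta>" using \<beta>(2) by (auto simp: ends_def edge_def)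
  show ?thesis
  proof (cases "\<alpha> = \<beta>")
    case False
    then obtain z where z: "z \<in> ends N \<alpha> \<inter> ends N \<beta>"
      using is_networkD(6)[OF net \<alpha> \<beta>(1)] v(2) v\<beta> by blast
    then have "edge N \<alpha> \<inter> edge N \<beta> = {z}" using is_networkD(5)[OF net \<alpha> \<beta>(1) False] by blast
    then have "v = z" using v(2) v\<beta> by auto
    then show ?thesis using z by simp
  qed (use \<beta> in simp)
qed

lemma param_vertex_iff:
  assumes net: "is_network N" and \<alpha>: "\<alpha> \<in> idx N" and s: "s \<in> {0..len N \<alpha>}"
  shows "param N \<alpha> s \<in> verts N \<longleftrightarrow> s = 0 \<or> s = len N \<alpha>"
proof
  note L = edge_ends[OF net \<alpha>]
  assume "param N \<alpha> s \<in> verts N"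
  then have "param N \<alpha> s \<in> ends N \<alpha>"
    using vertex_on_edge_is_end[OF net \<alpha>] param_image_edge[OF L(4)] s by blast
  then have "param N \<alpha> s = param N \<alpha> 0 \<or> param N \<alpha> s = param N \<alpha> (len N \<alpha>)"
    by (simp add: ends_def param_0 param_len[OF L(4)])
  then show "s = 0 \<or> s = len N \<alpha>" using inj_param[OF L(4)] by (auto dest: injD)
next
  assume "s = 0 \<or> s = len N \<alpha>"
  then show "param N \<alpha> s \<in> verts N"
    using edge_ends[OF net \<alpha>] by (auto simp: param_0 param_len)
qed

lemma finite_incident: "is_network N \<Longrightarrow> finite (incident N v)"
  by (simp add: incident_def is_networkD)

section \<open>Derivatives along an edge\<close>

lemma Ck_net_2_edge:
  assumes C2: "Ck_net 2 N u" and \<alpha>: "\<alpha> \<in> idx N" and L: "0 < len N \<alpha>"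
  shows "\<And>s. s \<in> {0..len N \<alpha>} \<Longrightarrow>
      (on_edge N u \<alpha> has_real_derivative edge_deriv N u \<alpha> s) (at s within {0..len N \<alpha>})"
    and "\<And>s. s \<in> {0..len N \<alpha>} \<Longrightarrow>
      (edge_deriv N u \<alpha> has_real_derivative edge_deriv2 N u \<alpha> s) (at s within {0..len N \<alpha>})"
    and "continuous_on {0..len N \<alpha>} (edge_deriv2 N u \<alpha>)"
proof -
  let ?I = "{0..len N \<alpha>}"
  obtain D :: "nat \<Rightarrow> real \<Rightarrow> real" where D0: "\<And>s. s \<in> ?I \<Longrightarrow> D 0 s = on_edge N u \<alpha> s"
    and D: "\<And>i s. i < 2 \<Longrightarrow> s \<in> ?I \<Longrightarrow> (D i has_real_derivative D (Suc i) s) (at s within ?I)"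
    and cD: "\<And>i. i \<le> 2 \<Longrightarrow> continuous_on ?I (D i)"
    using bspec[OF C2[unfolded Ck_net_def, THEN conjunct2] \<alpha>]
    unfolding Ck_on_interval_def by metis
  have 1: "(on_edge N u \<alpha> has_real_derivative D 1 s) (at s within ?I)" if "s \<in> ?I" for s
    by (rule has_field_derivative_transform_within[where f = "D 0" and d = 1])
      (use that D[of 0 s] D0 in auto)
  have e1: "edge_deriv N u \<alpha> s = D 1 s" if "s \<in> ?I" for s
    unfolding edge_deriv_def using that L 1[OF that]
    by (intro vector_derivative_within_closed_interval)
      (auto simp: has_real_derivative_iff_has_vector_derivative)
  have 2: "(edge_deriv N u \<alpha> has_real_derivative D 2 s) (at s within ?I)" if "s \<in> ?I" for s
    by (rule has_field_derivative_transform_within[where f = "D 1" and d = 1])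
      (use that D[of 1 s] e1 in \<open>auto simp: numeral_2_eq_2\<close>)
  have e2: "edge_deriv2 N u \<alpha> s = D 2 s" if "s \<in> ?I" for s
    unfolding edge_deriv2_def using that L 2[OF that]
    by (intro vector_derivative_within_closed_interval)
      (auto simp: has_real_derivative_iff_has_vector_derivative)
  show "(on_edge N u \<alpha> has_real_derivative edge_deriv N u \<alpha> s) (at s within ?I)" if "s \<in> ?I" for s
    using 1 e1 that by simp
  show "(edge_deriv N u \<alpha> has_real_derivative edge_deriv2 N u \<alpha> s) (at s within ?I)"
    if "s \<in> ?I" for s
    using 2 e2 that by simp
  show "continuous_on ?I (edge_deriv2 N u \<alpha>)"
    using continuous_on_cong[of ?I ?I "edge_deriv2 N u \<alpha>" "D 2"] e2 cD[of 2] by simp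
qed

lemma continuous_on_edge:
  assumes "Ck_net 2 N u" and "\<alpha> \<in> idx N" and "0 < len N \<alpha>"
  shows "continuous_on {0..len N \<alpha>} (on_edge N u \<alpha>)"
    and "continuous_on {0..len N \<alpha>} (edge_deriv N u \<alpha>)"
  using Ck_net_2_edge[OF assms] by (blast intro: DERIV_continuous_on)+

lemma deriv_on_edge_diff:
  assumes u: "Ck_net 2 N u" and v: "Ck_net 2 N v" and \<alpha>: "\<alpha> \<in> idx N" and L: "0 < len N \<alpha>"
    and s: "s \<in> {0..len N \<alpha>}"
  shows "((\<lambda>t. on_edge N u \<alpha> t - on_edge N v \<alpha> t) has_real_derivative
      edge_deriv N u \<alpha> s - edge_deriv N v \<alpha> s) (at s within {0..len N \<alpha>})"
    and "((\<lambda>t. edge_deriv N u \<alpha> t - edge_deriv N v \<alpha> t) has_real_derivative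
      edge_deriv2 N u \<alpha> s - edge_deriv2 N v \<alpha> s) (at s within {0..len N \<alpha>})"
  using Ck_net_2_edge(1,2)[OF u \<alpha> L s] Ck_net_2_edge(1,2)[OF v \<alpha> L s]
  by (auto intro: DERIV_diff)

section \<open>The maximum principle\<close>

lemma network_max_attained:
  assumes net: "is_network N" and u: "Ck_net 2 N u" and v: "Ck_net 2 N v" and ne: "net N \<noteq> {}"
  obtains x where "x \<in> net N" and "\<And>y. y \<in> net N \<Longrightarrow> u y - v y \<le> u x - v x"
proof -
  let ?w = "\<lambda>x. u x - v x"
  have ew: "compact (?w ` edge N \<alpha>)" if \<alpha>: "\<alpha> \<in> idx N" for \<alpha>
  proof -
    note L = edge_ends(4)[OF net \<alpha>]
    have "continuous_on {0..len N \<alpha>} (\<lambda>s. on_edge N u \<alpha> s - on_edge N v \<alpha> s)"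
      by (intro continuous_intros continuous_on_edge u v \<alpha> L)
    then have "compact ((\<lambda>s. on_edge N u \<alpha> s - on_edge N v \<alpha> s) ` {0..len N \<alpha>})"
      by (intro compact_continuous_image) auto
    also have "(\<lambda>s. on_edge N u \<alpha> s - on_edge N v \<alpha> s) ` {0..len N \<alpha>} = ?w ` edge N \<alpha>"
      by (simp add: on_edge_def image_image flip: param_image_edge[OF L])
    finally show ?thesis .
  qed
  have "compact (\<Union>\<alpha>\<in>idx N. ?w ` edge N \<alpha>)"
    using net ew by (intro compact_UN) (auto simp: is_networkD)
  then have "compact (?w ` net N)" by (simp add: net_def image_UN)
  then obtain m where "m \<in> ?w ` net N" "\<forall>y\<in>?w ` net N. y \<le> m"
    using compact_attains_sup[of "?w ` net N"] ne by auto
  then show ?thesis using that by auto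
qed

text \<open>Inside the edge the difference of the two differential inequalities holds by hypothesis. All
  its terms are continuous up to the ends once \<open>H\<close> is replaced by its extension \<open>H\<^sub>\<alpha>\<close>, so it
  persists there.\<close>

lemma sub_super_ineq_closed_edge:
  assumes net: "is_network N" and H2: "H2 N Q"
    and u: "sub_solution N Q F u" and v: "super_solution N Q F v"
    and \<alpha>: "\<alpha> \<in> idx N" and s: "s \<in> {0..len N \<alpha>}"
  shows "- mu Q \<alpha> * (edge_deriv2 N u \<alpha> s - edge_deriv2 N v \<alpha> s)
     + (ham_edge N (ham Q) \<alpha> (param N \<alpha> s) (edge_deriv N u \<alpha> s)
        - ham_edge N (ham Q) \<alpha> (param N \<alpha> s) (edge_deriv N v \<alpha> s))
     + lam Q * (on_edge N u \<alpha> s - on_edge N v \<alpha> s) \<le> 0" (is "?f s \<le> 0")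
proof -
  note L = edge_ends(4)[OF net \<alpha>]
  have C2: "Ck_net 2 N u" "Ck_net 2 N v"
    using u v by (auto simp: sub_solution_def super_solution_def)
  have cH: "continuous_on (edge N \<alpha> \<times> UNIV) (\<lambda>(x, p). ham_edge N (ham Q) \<alpha> x p)"
    using H2 \<alpha> by (simp add: H2_def)
  have cp: "continuous_on {0..len N \<alpha>} (param N \<alpha>)"
    unfolding param_def by (intro continuous_intros)
  have cHg: "continuous_on {0..len N \<alpha>} (\<lambda>s. ham_edge N (ham Q) \<alpha> (param N \<alpha> s) (g s))"
    if g: "continuous_on {0..len N \<alpha>} g" for g
    using continuous_on_compose2[OF cH continuous_on_Pair[OF cp g]] param_image_edge[OF L] by auto
  have cf: "continuous_on {0..len N \<alpha>} ?f"
    by (intro continuous_intros cHg continuous_on_edge Ck_net_2_edge(3) C2 \<alpha> L)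
  have inner: "?f t \<le> 0" if t: "t \<in> {0<..<len N \<alpha>}" for t
  proof -
    have t': "t \<in> {0..len N \<alpha>}" and nv: "param N \<alpha> t \<notin> verts N"
      using t param_vertex_iff[OF net \<alpha>, of t] by auto
    have "hjb_op N Q u \<alpha> t \<le> F (param N \<alpha> t)" "F (param N \<alpha> t) \<le> hjb_op N Q v \<alpha> t"
      using u v \<alpha> t' nv by (auto simp: sub_solution_def super_solution_def)
    then show ?thesis
      using nv by (simp add: hjb_op_def ham_edge_def on_edge_def algebra_simps)
  qed
  have cl: "closure {0<..<len N \<alpha>} = {0..len N \<alpha>}" using L by simp
  show ?thesis
    by (rule continuous_le_on_closure[of "{0<..<len N \<alpha>}" ?f]) (use cl cf s inner in auto)
qed

text \<open>At a critical point of \<open>u - v\<close> both Hamiltonian terms are \<open>H\<^sub>\<alpha>\<close> at the same point and the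
  same gradient; this is where the nonlinearity disappears.\<close>

lemma nonpos_at_critical_edge_max:
  assumes net: "is_network N" and H1: "H1 N Q" and H2: "H2 N Q"
    and u: "sub_solution N Q F u" and v: "super_solution N Q F v"
    and \<alpha>: "\<alpha> \<in> idx N" and s: "s \<in> {0..len N \<alpha>}"
    and max: "\<And>t. t \<in> {0..len N \<alpha>} \<Longrightarrow>
      on_edge N u \<alpha> t - on_edge N v \<alpha> t \<le> on_edge N u \<alpha> s - on_edge N v \<alpha> s"
    and crit: "edge_deriv N u \<alpha> s = edge_deriv N v \<alpha> s"
  shows "on_edge N u \<alpha> s - on_edge N v \<alpha> s \<le> 0"
proof -
  note L = edge_ends(4)[OF net \<alpha>]
  have C2: "Ck_net 2 N u" "Ck_net 2 N v"
    using u v by (auto simp: sub_solution_def super_solution_def)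
  have pos: "mu Q \<alpha> > 0" "lam Q > 0" using H1 \<alpha> by (auto simp: H1_def)
  have "edge_deriv2 N u \<alpha> s - edge_deriv2 N v \<alpha> s \<le> 0"
    using interval_max_second_deriv[OF L deriv_on_edge_diff(1)[OF C2 \<alpha> L]
        deriv_on_edge_diff(2)[OF C2 \<alpha> L s] s max] crit by simp
  then have "mu Q \<alpha> * (edge_deriv2 N u \<alpha> s - edge_deriv2 N v \<alpha> s) \<le> 0"
    using pos(1) by (simp add: mult_nonneg_nonpos)
  then have "lam Q * (on_edge N u \<alpha> s - on_edge N v \<alpha> s) \<le> 0"
    using sub_super_ineq_closed_edge[OF net H2 u v \<alpha> s] crit by simp
  then show ?thesis using pos(2) by (simp add: mult_le_0_iff)
qed

lemma outward_deriv_nonneg_at_vertex_max: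
  assumes net: "is_network N" and C2: "Ck_net 2 N u" "Ck_net 2 N v"
    and x: "x \<in> verts N" and max: "\<And>y. y \<in> net N \<Longrightarrow> u y - v y \<le> u x - v x"
    and \<alpha>: "\<alpha> \<in> incident N x"
  shows "outward_deriv N v \<alpha> x \<le> outward_deriv N u \<alpha> x"
proof -
  have \<alpha>': "\<alpha> \<in> idx N" "x \<in> edge N \<alpha>" using \<alpha> by (auto simp: incident_def)
  note L = edge_ends(4)[OF net \<alpha>'(1)]
  have onmax: "on_edge N u \<alpha> t - on_edge N v \<alpha> t \<le> u x - v x" if "t \<in> {0..len N \<alpha>}" for t
    using max[of "param N \<alpha> t"] param_image_edge[OF L] that \<alpha>'(1)
    unfolding net_def on_edge_def by blast
  show ?thesis
  proof (cases "x = src N \<alpha>")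
    case True
    have "edge_deriv N u \<alpha> 0 - edge_deriv N v \<alpha> 0 \<le> 0"
      using interval_max_first_deriv(1)[OF deriv_on_edge_diff(1)[OF C2 \<alpha>'(1) L, of 0]] onmax L True
      by (simp add: on_edge_def param_0)
    then show ?thesis using True by (simp add: outward_deriv_def)
  next
    case False
    then have xt: "x = tgt N \<alpha>"
      using vertex_on_edge_is_end[OF net \<alpha>'(1) x \<alpha>'(2)] by (simp add: ends_def)
    have "edge_deriv N u \<alpha> (len N \<alpha>) - edge_deriv N v \<alpha> (len N \<alpha>) \<ge> 0"
      using interval_max_first_deriv(2)[OF deriv_on_edge_diff(1)[OF C2 \<alpha>'(1) L, of "len N \<alpha>"]]
        onmax L xt by (simp add: on_edge_def param_len)
    then show ?thesis using False by (simp add: outward_deriv_def)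
  qed
qed

text \<open>The differences of the outward derivatives are nonnegative, and at an inner vertex they have a
  nonpositive sum when weighted by \<open>\<mu>\<^sub>\<alpha> \<gamma>\<^sub>v\<^sub>\<alpha> > 0\<close>: the Kirchhoff conditions bound it by
  \<open>- \<eta> \<lambda> (u - v)(x)\<close>, where \<open>\<theta>\<close> has cancelled. Positivity of \<open>u - v\<close> at \<open>x\<close> gives the sign.\<close>

lemma outward_deriv_zero_at_vertex_max:
  assumes net: "is_network N" and H1: "H1 N Q"
    and u: "sub_solution N Q F u" and v: "super_solution N Q F v"
    and x: "x \<in> verts N" and max: "\<And>y. y \<in> net N \<Longrightarrow> u y - v y \<le> u x - v x"
    and pos: "u x - v x > 0" and \<alpha>: "\<alpha> \<in> incident N x"
  shows "outward_deriv N u \<alpha> x = outward_deriv N v \<alpha> x"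
proof -
  have C2: "Ck_net 2 N u" "Ck_net 2 N v"
    using u v by (auto simp: sub_solution_def super_solution_def)
  note ge = outward_deriv_nonneg_at_vertex_max[OF net C2 x max]
  show ?thesis
  proof (cases "x \<in> bdry N")
    case True
    then have "outward_deriv N u \<alpha> x \<le> 0" "0 \<le> outward_deriv N v \<alpha> x"
      using u v \<alpha> by (auto simp: sub_solution_def super_solution_def)
    then show ?thesis using ge[OF _ \<alpha>] by simp
  next
    case False
    then have inner: "x \<in> verts N - bdry N" using x by blast
    define c where "c \<beta> = mu Q \<beta> * gam Q x \<beta>" for \<beta>
    define d where "d \<beta> = outward_deriv N u \<beta> x - outward_deriv N v \<beta> x" for \<beta>
    have c: "c \<beta> > 0" if "\<beta> \<in> incident N x" for \<beta>
      using H1 inner that by (auto simp: H1_def c_def incident_def)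
    have d: "d \<beta> \<ge> 0" if "\<beta> \<in> incident N x" for \<beta>
      using ge[OF _ that] by (simp add: d_def)
    have "(\<Sum>\<beta>\<in>incident N x. c \<beta> * d \<beta>) = kirchhoff_sum N Q u x - kirchhoff_sum N Q v x"
      by (simp add: kirchhoff_sum_def c_def d_def right_diff_distrib sum_subtractf)
    also have "\<dots> \<le> eta Q x * (theta Q x - lam Q * u x) - eta Q x * (theta Q x - lam Q * v x)"
      using u v inner by (intro diff_mono) (auto simp: sub_solution_def super_solution_def)
    also have "\<dots> = - (eta Q x * (lam Q * (u x - v x)))" by (simp add: algebra_simps)
    also have "\<dots> \<le> 0" using H1 inner pos by (simp add: H1_def)
    finally have "(\<Sum>\<beta>\<in>incident N x. c \<beta> * d \<beta>) \<le> 0" .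
    moreover have nn: "c \<beta> * d \<beta> \<ge> 0" if "\<beta> \<in> incident N x" for \<beta>
      using c[OF that] d[OF that] by simp
    ultimately have "(\<Sum>\<beta>\<in>incident N x. c \<beta> * d \<beta>) = 0"
      by (meson antisym sum_nonneg)
    then have "c \<alpha> * d \<alpha> = 0"
      using sum_nonneg_eq_0_iff[OF finite_incident[OF net], of x "\<lambda>\<beta>. c \<beta> * d \<beta>"] nn \<alpha> by simp
    then show ?thesis using c[OF \<alpha>] by (simp add: d_def)
  qed
qed

theorem comparison_principle:
  assumes net: "is_network N" and H1: "H1 N Q" and H2: "H2 N Q"
    and u: "sub_solution N Q F u" and v: "super_solution N Q F v" and y: "y \<in> net N"
  shows "u y \<le> v y"
proof -
  have C2: "Ck_net 2 N u" "Ck_net 2 N v"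
    using u v by (auto simp: sub_solution_def super_solution_def)
  obtain x where x: "x \<in> net N" and max: "\<And>z. z \<in> net N \<Longrightarrow> u z - v z \<le> u x - v x"
    using network_max_attained[OF net C2] y by blast
  have "u x - v x \<le> 0"
  proof (rule ccontr)
    assume "\<not> u x - v x \<le> 0"
    then have pos: "u x - v x > 0" by simp
    obtain \<alpha> where \<alpha>: "\<alpha> \<in> idx N" "x \<in> edge N \<alpha>" using x by (auto simp: net_def)
    note L = edge_ends(4)[OF net \<alpha>(1)]
    obtain s where s: "s \<in> {0..len N \<alpha>}" "x = param N \<alpha> s"
      using \<alpha>(2) param_image_edge[OF L] by blast
    have onx: "on_edge N u \<alpha> s - on_edge N v \<alpha> s = u x - v x" using s by (simp add: on_edge_def)
    have onmax: "on_edge N u \<alpha> t - on_edge N v \<alpha> t \<le> on_edge N u \<alpha> s - on_edge N v \<alpha> s"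
      if "t \<in> {0..len N \<alpha>}" for t
      using max[of "param N \<alpha> t"] param_image_edge[OF L] that \<alpha>(1) s(2)
      unfolding net_def on_edge_def by blast
    have "edge_deriv N u \<alpha> s = edge_deriv N v \<alpha> s"
    proof (cases "x \<in> verts N")
      case True
      have "\<alpha> \<in> incident N x" using \<alpha> by (simp add: incident_def)
      note out = outward_deriv_zero_at_vertex_max[OF net H1 u v True max pos this]
      have "s = 0 \<or> s = len N \<alpha>" using True s param_vertex_iff[OF net \<alpha>(1) s(1)] by simp
      then show ?thesis
        using out s(2) L edge_ends(3)[OF net \<alpha>(1)]
        by (auto simp: outward_deriv_def param_0 param_len)
    next
      case False
      then have "0 < s" "s < len N \<alpha>" using s param_vertex_iff[OF net \<alpha>(1) s(1)] by auto
      then show ?thesis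
        using interval_max_first_deriv[OF deriv_on_edge_diff(1)[OF C2 \<alpha>(1) L s(1)] s(1) onmax]
        by simp
    qed
    then show False
      using nonpos_at_critical_edge_max[OF net H1 H2 u v \<alpha>(1) s(1) onmax] onx pos by simp
  qed
  then show ?thesis using max[OF y] by simp
qed

lemma classical_solution_sub_super:
  assumes "classical_solution N Q F u"
  shows "sub_solution N Q F u" and "super_solution N Q F u"
  using assms by (auto simp: classical_solution_def sub_solution_def super_solution_def)

theorem proposition4p3:
  fixes N :: "('a::euclidean_space, 'i) network"
    and Q :: "('a, 'i) hjb_data"
    and F :: "'a \<Rightarrow> real"
  assumes "is_network N" and "H1 N Q" and "H2 N Q"
  shows "(\<forall>u v. sub_solution N Q F u \<and> super_solution N Q F v \<longrightarrow> (\<forall>x\<in>net N. u x \<le> v x)) \<and>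
    (\<forall>u v. classical_solution N Q F u \<and> classical_solution N Q F v \<longrightarrow> (\<forall>x\<in>net N. u x = v x))"
  using comparison_principle[OF assms] classical_solution_sub_super by (metis antisym)

end
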